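(* Let $A,B\subset\mathcal{E}$ be closed and let $\lambda\in(0,1)$. Let $U\subset\mathcal{E}$ be an open set such that $T_{\mathrm{DR}\lambda}$ is single-valued at each of its fixed points in $U$. Then $$\operatorname{Fix}T_{\mathrm{DR}\lambda}\cap U\subset\mathcal{M}:=\left\{f-\tfrac{\lambda}{1-\lambda}(f-e)\ :\ f\in P_B\!\left(f-\tfrac{\lambda}{1-\lambda}(f-e)\right),\ e\in P_A(f)\right\}\cap U.$$ Moreover, the inclusion is tight, i.e. $\operatorname{Fix}T_{\mathrm{DR}\lambda}\cap U=\mathcal{M}$, if $e\in P_A\!\left(f+\tfrac{\lambda}{1-\lambda}(f-e)\right)$ holds for the pairs $(f,e)$ appearing in the right-hand side.
   Context: $\mathcal{E}$ is a finite-dimensional Euclidean space. For $C\subset\mathcal{E}$ the projector is the set-valued map $P_C(x)=\{z\in C:\|z-x\|=\inf_{y\in C}\|x-y\|\}$ and the reflector is $R_C(x)=2P_C(x)-x$ (set-valued). The relaxed Douglas–Rachford mapping is $T_{\mathrm{DR}\lambda}(x)=\left\{\tfrac{\lambda}{2}\big(R_A(2b-x)+x\big)+(1-\lambda)b : b\in P_B(x)\right\}$ (set-valued; $R_A(2b-x)$ ranges over all its elements). $\operatorname{Fix}T=\{x:x\in T(x)\}$. $T$ is single-valued at $x$ if $T(x)$ is a singleton. *)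

theory Defs
  imports "HOL-Analysis.Analysis"
begin

definition projector :: "'a::euclidean_space set \<Rightarrow> 'a \<Rightarrow> 'a set" where
  "projector C x = {z \<in> C. norm (z - x) = (INF y\<in>C. norm (x - y))}"

definition reflector :: "'a::euclidean_space set \<Rightarrow> 'a \<Rightarrow> 'a set" where
  "reflector C x = {2 *\<^sub>R p - x | p. p \<in> projector C x}"

definition relaxed_DR ::
  "'a::euclidean_space set \<Rightarrow> 'a set \<Rightarrow> real \<Rightarrow> 'a \<Rightarrow> 'a set" where
  "relaxed_DR A B lam x =
     {(lam / 2) *\<^sub>R (r + x) + (1 - lam) *\<^sub>R b | b r.
        b \<in> projector B x \<and> r \<in> reflector A (2 *\<^sub>R b - x)}"

definition Fix :: "('a \<Rightarrow> 'a set) \<Rightarrow> 'a set" where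
  "Fix T = {x. x \<in> T x}"

definition single_valued_at :: "('a \<Rightarrow> 'a set) \<Rightarrow> 'a \<Rightarrow> bool" where
  "single_valued_at T x \<longleftrightarrow> is_singleton (T x)"

definition M_set ::
  "'a::euclidean_space set \<Rightarrow> 'a set \<Rightarrow> real \<Rightarrow> 'a set \<Rightarrow> 'a set" where
  "M_set A B lam U =
     {f - (lam / (1 - lam)) *\<^sub>R (f - e) | f e.
        f \<in> projector B (f - (lam / (1 - lam)) *\<^sub>R (f - e)) \<and> e \<in> projector A f} \<inter> U"

end

(* For x = b - mu (b - a) with mu = lam / (1 - lam), the reflected point 2 b - x is
   b + mu (b - a), and x is fixed exactly when a projects this point onto A. Since b lies on
   the segment from a to b + mu (b - a), such an a is also a projection of b. *)

theory Submission
  imports Defs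
begin

lemma projector_iff:
  "z \<in> projector C x \<longleftrightarrow> z \<in> C \<and> (\<forall>y\<in>C. norm (z - x) \<le> norm (y - x))"
\<comment> \<open>The case \<open>z \<in> C\<close> also makes \<open>C\<close> nonempty, which the
  greatest-lower-bound rule for a real infimum requires. In the other case both sides are
  false.\<close>
proof (cases "z \<in> C")
  case True
  have bdd: "bdd_below ((\<lambda>y. norm (x - y)) ` C)"
    by (rule bdd_belowI[of _ 0]) auto
  have "(INF y\<in>C. norm (x - y)) \<le> norm (x - y)" if "y \<in> C" for y
    using bdd that by (rule cINF_lower)
  moreover have "norm (z - x) \<le> (INF y\<in>C. norm (x - y))"
    if "\<forall>y\<in>C. norm (z - x) \<le> norm (y - x)"
    using True that by (intro cINF_greatest) (auto simp: norm_minus_commute)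
  ultimately have "norm (z - x) = (INF y\<in>C. norm (x - y)) \<longleftrightarrow>
      (\<forall>y\<in>C. norm (z - x) \<le> norm (y - x))"
    by (metis antisym True norm_minus_commute)
  with True show ?thesis
    by (simp add: projector_def)
qed (simp add: projector_def)

text \<open>The point \<open>b + m *\<^sub>R (b - a)\<close> lies at distance
  \<open>m * norm (a - b)\<close> from \<open>b\<close> and \<open>(1 + m) * norm (a - b)\<close>
  from \<open>a\<close>. A point of \<open>A\<close> closer to \<open>b\<close> than
  \<open>a\<close> would, by the triangle inequality through \<open>b\<close>, also be closer to
  that point.\<close>

lemma projector_segment:
  assumes "a \<in> projector A (b + m *\<^sub>R (b - a))" and "0 \<le> m"
  shows "a \<in> projector A b"
proof -
  have "norm (a - b) \<le> norm (c - b)" if "c \<in> A" for c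
  proof -
    have "a - (b + m *\<^sub>R (b - a)) = (1 + m) *\<^sub>R (a - b)"
      by (simp add: algebra_simps)
    then have "(1 + m) * norm (a - b) = norm (a - (b + m *\<^sub>R (b - a)))"
      using assms(2) by simp
    also have "\<dots> \<le> norm (c - (b + m *\<^sub>R (b - a)))"
      using assms(1) that by (simp add: projector_iff)
    also have "\<dots> \<le> norm (c - b) + m * norm (a - b)"
      using norm_triangle_ineq4[of "c - b" "m *\<^sub>R (b - a)"] assms(2)
      by (simp add: diff_diff_eq norm_minus_commute[of a b])
    finally show ?thesis
      by (simp add: algebra_simps)
  qed
  with assms(1) show ?thesis
    by (simp add: projector_iff)
qed

text \<open>This brings fixed points into the shape of \<open>M_set\<close>, with \<open>b\<close>
  and \<open>a\<close> as \<open>f\<close> and \<open>e\<close>. The only difference left is the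
  point that \<open>a\<close> projects: \<open>b + (lam / (1 - lam)) *\<^sub>R (b - a)\<close> here,
  \<open>b\<close> there.\<close>

lemma Fix_relaxed_DR_iff:
  assumes "lam \<noteq> 1"
  shows "x \<in> Fix (relaxed_DR A B lam) \<longleftrightarrow>
    (\<exists>b a. b \<in> projector B x \<and> a \<in> projector A (b + (lam / (1 - lam)) *\<^sub>R (b - a)) \<and>
           x = b - (lam / (1 - lam)) *\<^sub>R (b - a))"
proof -
  \<comment> \<open>The equation is affine in \<open>x\<close>, and \<open>x\<close> has coefficient
    \<open>lam\<close> on its right side. Collecting \<open>x\<close> leaves the factor
    \<open>1 - lam\<close>, which is nonzero and can be cancelled.\<close>
  have step: "x = (lam / 2) *\<^sub>R ((2 *\<^sub>R a - (2 *\<^sub>R b - x)) + x) + (1 - lam) *\<^sub>R b \<longleftrightarrow>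
      x = b - (lam / (1 - lam)) *\<^sub>R (b - a)" (is "x = ?t \<longleftrightarrow> x = ?p") for a b
  proof -
    have "(1 - lam) *\<^sub>R ?p = (1 - lam) *\<^sub>R b - lam *\<^sub>R (b - a)"
      using assms by (simp add: scaleR_diff_right)
    moreover have "?t = lam *\<^sub>R x + ((1 - lam) *\<^sub>R b - lam *\<^sub>R (b - a))"
      by (simp add: algebra_simps flip: scaleR_add_left)
    ultimately have "x - ?t = (1 - lam) *\<^sub>R (x - ?p)"
      by (simp add: algebra_simps)
    then have "x - ?t = 0 \<longleftrightarrow> x - ?p = 0"
      using assms by (simp only: scaleR_eq_0_iff) simp
    then show ?thesis
      by (simp only: right_minus_eq)
  qed
  \<comment> \<open>This rewriting is valid only under the fixed-point equation, which stands in the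
    same conjunction as the membership to be rewritten.\<close>
  have reflect: "2 *\<^sub>R b - x = b + m *\<^sub>R (b - a)" if "x = b - m *\<^sub>R (b - a)" for a b m
    unfolding that by (simp add: scaleR_2)
  have "x \<in> Fix (relaxed_DR A B lam) \<longleftrightarrow>
    (\<exists>b a. b \<in> projector B x \<and> a \<in> projector A (2 *\<^sub>R b - x) \<and>
           x = (lam / 2) *\<^sub>R ((2 *\<^sub>R a - (2 *\<^sub>R b - x)) + x) + (1 - lam) *\<^sub>R b)"
    unfolding Fix_def relaxed_DR_def reflector_def by blast
  then show ?thesis
    unfolding step using reflect by metis
qed

theorem theorem3p13:
  fixes A B U :: "'a::euclidean_space set" and lam :: real
  assumes "closed A" and "closed B"
    and "0 < lam" and "lam < 1"
    and "open U"
    and "\<forall>x \<in> Fix (relaxed_DR A B lam) \<inter> U. single_valued_at (relaxed_DR A B lam) x"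
  shows "Fix (relaxed_DR A B lam) \<inter> U \<subseteq> M_set A B lam U \<and>
    ((\<forall>f e. f \<in> projector B (f - (lam / (1 - lam)) *\<^sub>R (f - e)) \<and> e \<in> projector A f \<and>
            f - (lam / (1 - lam)) *\<^sub>R (f - e) \<in> U \<longrightarrow>
            e \<in> projector A (f + (lam / (1 - lam)) *\<^sub>R (f - e)))
      \<longrightarrow> Fix (relaxed_DR A B lam) \<inter> U = M_set A B lam U)"
proof -
  define m where "m = lam / (1 - lam)"
  have "0 \<le> m"
    using assms(3,4) by (simp add: m_def)
  have "lam \<noteq> 1"
    using assms(4) by simp
  note fix_iff = Fix_relaxed_DR_iff[OF this, folded m_def]
  \<comment> \<open>The pair \<open>(b, a)\<close> of a fixed point serves as \<open>(f, e)\<close>;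
    \<open>projector_segment\<close> moves the projection from the far point back to
    \<open>b\<close>.\<close>
  have "Fix (relaxed_DR A B lam) \<inter> U \<subseteq> M_set A B lam U"
    using projector_segment[OF _ \<open>0 \<le> m\<close>]
    unfolding M_set_def m_def[symmetric] by (clarsimp simp only: fix_iff) blast
  \<comment> \<open>The assumed membership is the one conjunct that a pair from \<open>M_set\<close>
    lacks for \<open>fix_iff\<close>.\<close>
  moreover have "M_set A B lam U \<subseteq> Fix (relaxed_DR A B lam) \<inter> U"
    if "\<forall>f e. f \<in> projector B (f - m *\<^sub>R (f - e)) \<and> e \<in> projector A f \<and>
          f - m *\<^sub>R (f - e) \<in> U \<longrightarrow> e \<in> projector A (f + m *\<^sub>R (f - e))"
    using that unfolding M_set_def m_def[symmetric] by (clarsimp simp only: fix_iff) blast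
  ultimately show ?thesis
    unfolding m_def by blast
qed

end
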